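(* For all integers $n, r, t$ with $n \geq 0$, $r \geq 2$ and $1 \leq t \leq r-1$, we have $$|\mathcal{O}_{1,r}(n)| = |\mathcal{D}_{1,r}(n)| = E_{r,t}(n).$$
   Context: A partition $\lambda$ of a non-negative integer $n$ is a non-increasing finite sequence $\lambda = (\lambda_1, \lambda_2, \ldots, \lambda_\ell)$ of positive integers (the parts of $\lambda$) with $\sum_{i=1}^{\ell} \lambda_i = n$ (the empty sequence is the unique partition of $0$). The multiplicity of a part is the number of times it appears in $\lambda$. $\mathcal{O}_r(n)$ is the set of $r$-regular partitions of $n$, i.e., partitions of $n$ in which no part is divisible by $r$. $\mathcal{D}_r(n)$ is the set of partitions of $n$ in which no part appears more than $r-1$ times. $\mathcal{O}_{1,r}(n)$ is the set of partitions of $n$ in which the set of parts divisible by $r$ has exactly one element (i.e., exactly one part size is divisible by $r$, and this part may be repeated). $\mathcal{D}_{1,r}(n)$ is the set of partitions of $n$ in which exactly one part (i.e., exactly one part size) appears at least $r$ times. For a partition $\lambda$, $\ell_t(\lambda)$ denotes the number of parts of $\lambda$ congruent to $t \pmod r$, counted with multiplicity, and $\overline{\ell}_t(\lambda)$ denotes the number of different parts (part sizes) that appear at least $t$ times in $\lambda$, each counted once. The integer $E_{r,t}(n)$ is defined by $$E_{r,t}(n) = \sum_{\lambda \in \mathcal{O}_r(n)} \ell_t(\lambda) - \sum_{\lambda \in \mathcal{D}_r(n)} \overline{\ell}_t(\lambda).$$ *)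

theory Defs
  imports Main "HOL-Number_Theory.Cong"
begin

definition partitions :: "nat \<Rightarrow> nat list set" where
  "partitions n = {xs. sorted_wrt (\<ge>) xs \<and> (\<forall>x\<in>set xs. 0 < x) \<and> sum_list xs = n}"

definition regular_partitions :: "nat \<Rightarrow> nat \<Rightarrow> nat list set" where
  "regular_partitions r n = {xs \<in> partitions n. \<forall>x\<in>set xs. \<not> r dvd x}"

definition bounded_mult_partitions :: "nat \<Rightarrow> nat \<Rightarrow> nat list set" where
  "bounded_mult_partitions r n = {xs \<in> partitions n. \<forall>x\<in>set xs. count_list xs x \<le> r - 1}"

definition one_divisible_partitions :: "nat \<Rightarrow> nat \<Rightarrow> nat list set" where
  "one_divisible_partitions r n = {xs \<in> partitions n. card {x \<in> set xs. r dvd x} = 1}"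

definition one_repeated_partitions :: "nat \<Rightarrow> nat \<Rightarrow> nat list set" where
  "one_repeated_partitions r n =
     {xs \<in> partitions n. card {x \<in> set xs. r \<le> count_list xs x} = 1}"

definition num_parts_cong :: "nat \<Rightarrow> nat \<Rightarrow> nat list \<Rightarrow> nat" where
  "num_parts_cong r t xs = length (filter (\<lambda>x. [x = t] (mod r)) xs)"

definition num_sizes_repeated :: "nat \<Rightarrow> nat list \<Rightarrow> nat" where
  "num_sizes_repeated t xs = card {x \<in> set xs. t \<le> count_list xs x}"

definition E :: "nat \<Rightarrow> nat \<Rightarrow> nat \<Rightarrow> int" where
  "E r t n = (\<Sum>xs\<in>regular_partitions r n. int (num_parts_cong r t xs))
           - (\<Sum>xs\<in>bounded_mult_partitions r n. int (num_sizes_repeated t xs))"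

text \<open>Finiteness, so that no cardinality or sum over these sets is 0 by convention.\<close>

lemma finite_partitions: "finite (partitions n)"
proof (rule finite_subset)
  have "length xs \<le> sum_list xs" if "\<forall>x\<in>set xs. 0 < x" for xs :: "nat list"
    using that by (induction xs) auto
  then show "partitions n \<subseteq> {xs. set xs \<subseteq> {..n} \<and> length xs \<le> n}"
    by (auto simp: partitions_def member_le_sum_list)
  show "finite {xs. set xs \<subseteq> {..n} \<and> length xs \<le> n}"
    by (rule finite_lists_length_le) simp
qed

end

theory Submission
  imports Defs "HOL-Library.Multiset"
begin

text \<open>
  All three numbers are computed from a single operation: taking \<open>j\<close> copies of a part \<open>k\<close> out of
  the partitions of \<open>n\<close> in which \<open>k\<close> occurs at least \<open>j\<close> times leaves partitions of \<open>n - j * k\<close>,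
  and every condition that does not look at those copies survives
  (\<open>card_mpartitions_remove\<close>). In terms of generating functions this is division by
  \<open>q ^ (j * k)\<close>; working with it directly avoids infinite products.

  Write \<open>d(m)\<close> for the number of partitions of \<open>m\<close> whose multiplicities are all below \<open>r\<close>. By
  Glaisher's theorem (\<open>glaisher\<close>), \<open>d(m)\<close> also counts the \<open>r\<close>-regular partitions. Write \<open>p\<^sub>k(m)\<close>
  for the number of partitions of \<open>m\<close> in which every part other than \<open>k\<close> occurs fewer than \<open>r\<close>
  times. Splitting by whether \<open>k\<close> occurs \<open>r\<close> times gives \<open>p\<^sub>k(m) = d(m) + p\<^sub>k(m - r * k)\<close>, and
  everything reduces to \<open>p\<^sub>k\<close>:

  \<^item> In a partition with a single size \<open>k\<close> occurring at least \<open>r\<close> times, remove \<open>r\<close> copies of \<open>k\<close>: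
    there are \<open>\<Sum>\<^sub>k p\<^sub>k(n - r * k)\<close> of these.
  \<^item> In a partition whose only size divisible by \<open>r\<close> is \<open>r * k\<close>, remove one copy of it. What is left
    has no multiple of \<open>r\<close> other than \<open>r * k\<close>; the number of such partitions obeys the same recursion
    as \<open>p\<^sub>k\<close> because both kinds have the base term \<open>d\<close>, so the count is again
    \<open>\<Sum>\<^sub>k p\<^sub>k(n - r * k)\<close>.
  \<^item> Among partitions with multiplicities below \<open>r\<close>, those with at least \<open>t\<close> copies of \<open>k\<close> number
    \<open>p\<^sub>k(n - t * k) - p\<^sub>k(n - r * k)\<close>.
  \<^item> The parts congruent to \<open>t\<close> in all \<open>r\<close>-regular partitions of \<open>n\<close> number the sum of
    \<open>d(n - i * j)\<close> over \<open>i, j \<ge> 1\<close> with \<open>i\<close> congruent to \<open>t\<close>: here \<open>i\<close> is the part and \<open>j\<close> the index of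
    the copy. Exchanging the roles of \<open>i\<close> and \<open>j\<close>, that is, letting \<open>j\<close> be a part from which
    \<open>t, t + r, t + 2 * r, \<dots>\<close> copies are removed, turns this into \<open>\<Sum>\<^sub>k p\<^sub>k(n - t * k)\<close>, by
    unrolling the recursion (\<open>card_bounded_except_eq_sum\<close>).

  Summing the third count over \<open>k\<close> and subtracting it from the fourth leaves \<open>\<Sum>\<^sub>k p\<^sub>k(n - r * k)\<close>, the common value of the first two.
\<close>

section \<open>Partitions as multisets\<close>

text \<open>The size is an integer so that removing too many copies of a part leads to a negative size, for
  which there are no partitions, instead of a truncated difference.\<close>

definition mpartitions :: "int \<Rightarrow> nat multiset set" where
  "mpartitions n = {M. 0 \<notin># M \<and> int (sum_mset M) = n}"

\<comment> \<open>The size of a multiset is kept as one integer and not pushed into the summands, so that linear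
  arithmetic can relate sizes before and after a removal.\<close>
declare of_nat_sum_mset [simp del]

lemma bij_betw_mset_partitions:
  "bij_betw mset {xs \<in> partitions n. Q (mset xs)} {M \<in> mpartitions (int n). Q M}"
proof (rule bij_betwI')
  fix xs ys assume "xs \<in> {xs \<in> partitions n. Q (mset xs)}" "ys \<in> {xs \<in> partitions n. Q (mset xs)}"
  then have "sorted (rev xs)" "sorted (rev ys)"
    by (auto simp: partitions_def sorted_wrt_rev)
  then show "mset xs = mset ys \<longleftrightarrow> xs = ys"
    by (metis mset_rev properties_for_sort rev_rev_ident)
next
  fix xs assume "xs \<in> {xs \<in> partitions n. Q (mset xs)}"
  then show "mset xs \<in> {M \<in> mpartitions (int n). Q M}"
    by (auto simp: partitions_def mpartitions_def sum_mset_sum_list)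
next
  fix M assume M: "M \<in> {M \<in> mpartitions (int n). Q M}"
  define xs where "xs = rev (sorted_list_of_multiset M)"
  have ms: "mset xs = M" by (simp add: xs_def)
  moreover have "sorted_wrt (\<ge>) xs"
    by (simp add: xs_def sorted_wrt_rev)
  moreover have "\<forall>x\<in>set xs. 0 < x"
    using M ms by (metis (no_types, lifting) gr0I mem_Collect_eq mpartitions_def set_mset_mset)
  moreover have "sum_list xs = n"
    using M ms by (simp add: mpartitions_def flip: sum_mset_sum_list)
  ultimately show "\<exists>xs \<in> {xs \<in> partitions n. Q (mset xs)}. M = mset xs"
    using M by (auto simp: partitions_def)
qed

lemma finite_mpartitions: "finite (mpartitions n)"
proof (cases "n < 0")
  case True
  then have "mpartitions n = {}" by (auto simp: mpartitions_def)
  then show ?thesis by simp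
next
  case False
  then show ?thesis
    using bij_betw_finite[OF bij_betw_mset_partitions[of "nat n" "\<lambda>_. True"]] finite_partitions
    by simp
qed

lemma finite_mpartitions_Collect [simp]: "finite {M \<in> mpartitions n. Q M}"
  using finite_mpartitions by simp

lemma mpartitions_neg: "n < 0 \<Longrightarrow> mpartitions n = {}"
  by (auto simp: mpartitions_def)

lemma count_mult_le_sum_mset: "count M k * k \<le> sum_mset (M :: nat multiset)"
proof -
  have "replicate_mset (count M k) k \<subseteq># M"
    by (simp flip: count_le_replicate_mset_subset_eq)
  then obtain L where "M = replicate_mset (count M k) k + L"
    by (metis subset_mset.less_eqE)
  then have "sum_mset M = count M k * k + sum_mset L"
    by (metis sum_mset.union sum_mset_replicate_mset of_nat_id)
  then show ?thesis by simp
qed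

lemma mpartitions_bounds:
  assumes "M \<in> mpartitions (int n)" "x \<in># M"
  shows "x \<in> {1..n}" "count M x \<in> {1..n}"
proof -
  have "0 < x" using assms by (auto simp: mpartitions_def intro: gr0I)
  moreover have "1 \<le> count M x" using assms(2) by (simp add: Suc_le_eq)
  moreover have "count M x * x \<le> n"
    using count_mult_le_sum_mset[of M x] assms(1) by (simp add: mpartitions_def)
  moreover from calculation have "x \<le> count M x * x" "count M x \<le> count M x * x"
    using mult_le_mono1[of 1 "count M x" x] by simp_all
  ultimately have "x \<le> n" "count M x \<le> n" by linarith+
  with \<open>0 < x\<close> \<open>1 \<le> count M x\<close> show "x \<in> {1..n}" "count M x \<in> {1..n}"
    by (simp_all only: atLeastAtMost_iff Suc_le_eq One_nat_def)
qed

section \<open>Removing copies of a part\<close>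

text \<open>Adding the removed copies back inverts the removal. The condition \<open>Q\<close> is arbitrary and is evaluated
  after adding back; in each use below it ignores the copies of \<open>k\<close> or is known to accept them.\<close>

lemma card_mpartitions_remove:
  assumes "0 < k"
  shows "card {M \<in> mpartitions n. j \<le> count M k \<and> Q M}
       = card {M \<in> mpartitions (n - int (j * k)). Q (M + replicate_mset j k)}"
proof (rule bij_betw_same_card[of "\<lambda>M. M - replicate_mset j k"],
       rule bij_betw_byWitness[where f' = "\<lambda>M. M + replicate_mset j k"])
  have sub: "M - replicate_mset j k + replicate_mset j k = M" if "j \<le> count M k" for M
    using that by (simp add: count_le_replicate_mset_subset_eq)
  show "\<forall>M\<in>{M \<in> mpartitions n. j \<le> count M k \<and> Q M}.
          M - replicate_mset j k + replicate_mset j k = M"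
    using sub by blast
  show "\<forall>M\<in>{M \<in> mpartitions (n - int (j * k)). Q (M + replicate_mset j k)}.
          M + replicate_mset j k - replicate_mset j k = M"
    by simp
  show "(\<lambda>M. M - replicate_mset j k) ` {M \<in> mpartitions n. j \<le> count M k \<and> Q M}
      \<subseteq> {M \<in> mpartitions (n - int (j * k)). Q (M + replicate_mset j k)}"
  proof safe
    fix M assume M: "M \<in> mpartitions n" "j \<le> count M k" "Q M"
    show "Q (M - replicate_mset j k + replicate_mset j k)"
      using M sub by simp
    have "sum_mset M = sum_mset (M - replicate_mset j k) + j * k"
      using arg_cong[OF sub[OF M(2)], of sum_mset] by simp
    then show "M - replicate_mset j k \<in> mpartitions (n - int (j * k))"
      using M(1) by (auto simp: mpartitions_def dest: in_diffD)
  qed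
  show "(\<lambda>M. M + replicate_mset j k) `
          {M \<in> mpartitions (n - int (j * k)). Q (M + replicate_mset j k)}
      \<subseteq> {M \<in> mpartitions n. j \<le> count M k \<and> Q M}"
    using assms by (auto simp: mpartitions_def split: if_splits)
qed

lemma card_mpartitions_split:
  assumes "0 < k"
  shows "card {M \<in> mpartitions n. Q M}
       = card {M \<in> mpartitions n. count M k < j \<and> Q M}
       + card {M \<in> mpartitions (n - int (j * k)). Q (M + replicate_mset j k)}"
proof -
  have "{M \<in> mpartitions n. Q M} = {M \<in> mpartitions n. count M k < j \<and> Q M}
          \<union> {M \<in> mpartitions n. j \<le> count M k \<and> Q M}" by auto
  moreover have "card \<dots> = card {M \<in> mpartitions n. count M k < j \<and> Q M}
          + card {M \<in> mpartitions n. j \<le> count M k \<and> Q M}"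
    by (rule card_Un_disjoint) auto
  ultimately show ?thesis
    by (simp only: card_mpartitions_remove[OF assms])
qed

section \<open>Glaisher's theorem\<close>

text \<open>This interpolates between no condition (\<open>N = 0\<close>) and the two sides of Glaisher's theorem (\<open>N\<close> at
  least the size). Imposing the next condition subtracts, on one side, the partitions with \<open>r\<close> copies
  of \<open>N + 1\<close> and, on the other, those with one copy of \<open>r * (N + 1)\<close>. Both removals lower the size
  by \<open>r * (N + 1)\<close> and leave the conditions for \<open>1, \<dots>, N\<close> untouched, so the two sides satisfy the
  same recursion.\<close>

lemma card_low_mult_eq_card_no_low_multiples:
  assumes "0 < r"
  shows "card {M \<in> mpartitions n. \<forall>x\<in>{1..N}. count M x < r}
       = card {M \<in> mpartitions n. \<forall>x\<in>{1..N}. r * x \<notin># M}"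
proof (induction N arbitrary: n)
  case 0
  then show ?case by simp
next
  case (Suc N)
  let ?A = "\<lambda>N n. {M \<in> mpartitions n. \<forall>x\<in>{1..N}. count M x < r}"
  let ?B = "\<lambda>N n. {M \<in> mpartitions n. \<forall>x\<in>{1..N}. r * x \<notin># M}"
  let ?m = "n - int (r * Suc N)"
  have "card (?A N n) = card (?A (Suc N) n) + card (?A N ?m)"
    using card_mpartitions_split[of "Suc N" n "\<lambda>M. \<forall>x\<in>{1..N}. count M x < r" r]
    by (simp add: atLeastAtMostSuc_conv)
  moreover have "card (?B N n) = card (?B (Suc N) n) + card (?B N ?m)"
    using card_mpartitions_split[of "r * Suc N" n "\<lambda>M. \<forall>x\<in>{1..N}. r * x \<notin># M" 1] assms
    by (simp add: atLeastAtMostSuc_conv count_eq_zero_iff del: mult_Suc_right)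
  ultimately show ?case
    using Suc.IH[of n] Suc.IH[of ?m] by linarith
qed

lemma glaisher:
  assumes "0 < r"
  shows "card {M \<in> mpartitions n. \<forall>x. count M x < r}
       = card {M \<in> mpartitions n. \<forall>x\<in>#M. \<not> r dvd x}"
proof (cases "n < 0")
  case True
  then show ?thesis by (simp add: mpartitions_neg)
next
  case False
  then obtain N where N: "n = int N" by (metis nonneg_int_cases not_less)
  have "(\<forall>x\<in>{1..N}. count M x < r) \<longleftrightarrow> (\<forall>x. count M x < r)"
    if "M \<in> mpartitions n" for M
    using mpartitions_bounds(1)[of M N] that N assms by (metis not_in_iff)
  moreover have "(\<forall>x\<in>{1..N}. r * x \<notin># M) \<longleftrightarrow> (\<forall>x\<in>#M. \<not> r dvd x)"
    if M: "M \<in> mpartitions n" for M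
  proof
    assume *: "\<forall>x\<in>{1..N}. r * x \<notin># M"
    show "\<forall>x\<in>#M. \<not> r dvd x"
    proof (intro ballI notI)
      fix x assume x: "x \<in># M" "r dvd x"
      then obtain y where y: "x = r * y" by blast
      have "x \<in> {1..N}" using mpartitions_bounds(1) M N x by blast
      moreover from this have "y \<le> x" "0 < y" using y assms by auto
      ultimately have "y \<in> {1..N}" by simp
      then show False using * x(1) y by blast
    qed
  qed auto
  ultimately show ?thesis
    using card_low_mult_eq_card_no_low_multiples[OF assms, of n N]
    by (simp cong: conj_cong)
qed

section \<open>One exceptional part\<close>

definition bounded_except :: "nat \<Rightarrow> nat \<Rightarrow> int \<Rightarrow> nat multiset set" where
  "bounded_except r k n = {M \<in> mpartitions n. \<forall>x. x \<noteq> k \<longrightarrow> count M x < r}"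

lemma card_bounded_except_rec:
  assumes "0 < r" "0 < k"
  shows "card (bounded_except r k n)
       = card {M \<in> mpartitions n. \<forall>x. count M x < r} + card (bounded_except r k (n - int (r * k)))"
proof -
  have "{M \<in> mpartitions n. count M k < r \<and> (\<forall>x. x \<noteq> k \<longrightarrow> count M x < r)}
      = {M \<in> mpartitions n. \<forall>x. count M x < r}" by auto
  then show ?thesis
    using card_mpartitions_split[of k n "\<lambda>M. \<forall>x. x \<noteq> k \<longrightarrow> count M x < r" r] assms
    by (simp add: bounded_except_def)
qed

text \<open>Splitting off one copy of \<open>r * k\<close> on the left corresponds to splitting off \<open>r\<close> copies of \<open>k\<close> on the
  right. The terms without such copies agree by Glaisher's theorem, and the others by induction on
  the size.\<close>

lemma card_one_multiple_eq_card_bounded_except: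
  assumes "0 < r" "0 < k"
  shows "card {M \<in> mpartitions n. \<forall>x\<in>#M. r dvd x \<longrightarrow> x = r * k} = card (bounded_except r k n)"
proof (induction "nat n" arbitrary: n rule: less_induct)
  case less
  let ?Q = "\<lambda>n. {M \<in> mpartitions n. \<forall>x\<in>#M. r dvd x \<longrightarrow> x = r * k}"
  show ?case
  proof (cases "n < 0")
    case True
    then show ?thesis by (simp add: mpartitions_neg bounded_except_def)
  next
    case False
    have "count M (r * k) < 1 \<and> (\<forall>x\<in>#M. r dvd x \<longrightarrow> x = r * k)
        \<longleftrightarrow> (\<forall>x\<in>#M. \<not> r dvd x)" for M
      unfolding less_one count_eq_zero_iff by (metis dvd_triv_left)
    then have "{M \<in> mpartitions n. count M (r * k) < 1 \<and> (\<forall>x\<in>#M. r dvd x \<longrightarrow> x = r * k)}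
        = {M \<in> mpartitions n. \<forall>x\<in>#M. \<not> r dvd x}"
      by blast
    then have "card (?Q n) = card {M \<in> mpartitions n. \<forall>x\<in>#M. \<not> r dvd x}
                 + card (?Q (n - int (r * k)))"
      using card_mpartitions_split[of "r * k" n "\<lambda>M. \<forall>x\<in>#M. r dvd x \<longrightarrow> x = r * k" 1] assms
      by simp
    moreover have "card (?Q (n - int (r * k))) = card (bounded_except r k (n - int (r * k)))"
    proof (cases "n = 0")
      case True
      then show ?thesis using assms by (simp add: mpartitions_neg bounded_except_def)
    next
      case n0: False
      show ?thesis
        by (rule less) (use False n0 assms in \<open>simp add: nat_less_eq_zless flip: of_nat_mult\<close>)
    qed
    ultimately show ?thesis
      using card_bounded_except_rec[OF assms, of n] glaisher[OF assms(1), of n] by simp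
  qed
qed

text \<open>The recursion \<open>card_bounded_except_rec\<close>, unrolled from size \<open>n - s * k\<close> on. The index \<open>i\<close> is the total
  number of copies of \<open>k\<close> removed; beyond \<open>i = n\<close> the size is negative since \<open>k \<ge> 1\<close>.\<close>

lemma card_bounded_except_eq_sum:
  assumes "0 < r" "0 < k"
  shows "card (bounded_except r k (int n - int (s * k)))
       = (\<Sum>i | i \<in> {s..n} \<and> [i = s] (mod r).
            card {M \<in> mpartitions (int n - int (i * k)). \<forall>x. count M x < r})"
proof (induction "Suc n - s" arbitrary: s rule: less_induct)
  case less
  show ?case
  proof (cases "n < s")
    case True
    then have "n < s * k" using assms(2) by (metis less_le_trans mult.right_neutral mult_le_mono2 Suc_leI One_nat_def)
    then have "int n - int (s * k) < 0" by (simp del: of_nat_mult)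
    with True show ?thesis by (simp add: mpartitions_neg bounded_except_def del: of_nat_mult)
  next
    case False
    let ?I = "\<lambda>s. {i. i \<in> {s..n} \<and> [i = s] (mod r)}"
    have "?I s = insert s (?I (s + r))"
    proof (intro set_eqI iffI)
      fix i assume i: "i \<in> ?I s"
      then obtain q where "i = s + q * r"
        by (metis (no_types, lifting) atLeastAtMost_iff cong_le_nat cong_sym mem_Collect_eq add.commute)
      then show "i \<in> insert s (?I (s + r))"
        using i by (cases q) (auto simp: cong_def)
    qed (use False in \<open>auto simp: cong_def\<close>)
    moreover have "s \<notin> ?I (s + r)" using assms(1) by simp
    moreover have "finite (?I (s + r))" by simp
    moreover have "card (bounded_except r k (int n - int (s * k)))
        = card {M \<in> mpartitions (int n - int (s * k)). \<forall>x. count M x < r}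
        + card (bounded_except r k (int n - int ((s + r) * k)))"
      using card_bounded_except_rec[OF assms, of "int n - int (s * k)"]
      by (simp add: algebra_simps)
    ultimately show ?thesis
      using less[of "s + r"] False assms(1) by simp
  qed
qed

section \<open>The four counts\<close>

lemma card_singleton_eq_sum:
  assumes "finite S" "finite K" and "\<And>M x. M \<in> S \<Longrightarrow> R M x \<Longrightarrow> x \<in> K"
  shows "card {M \<in> S. card {x. R M x} = 1} = (\<Sum>k\<in>K. card {M \<in> S. {x. R M x} = {k}})"
proof -
  have "{M \<in> S. card {x. R M x} = 1} = (\<Union>k\<in>K. {M \<in> S. {x. R M x} = {k}})"
    using assms(3) by (auto simp: card_1_singleton_iff)
  moreover have "card \<dots> = (\<Sum>k\<in>K. card {M \<in> S. {x. R M x} = {k}})"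
    by (rule card_UN_disjoint) (use assms in auto)
  ultimately show ?thesis by simp
qed

lemma sum_card_swap:
  assumes "finite S" "finite K" and "\<And>M x. M \<in> S \<Longrightarrow> R M x \<Longrightarrow> x \<in> K"
  shows "(\<Sum>M\<in>S. card {x. R M x}) = (\<Sum>k\<in>K. card {M \<in> S. R M k})"
proof -
  have "{x. R M x} = {x \<in> K. R M x}" if "M \<in> S" for M using assms(3) that by auto
  then have "(\<Sum>M\<in>S. card {x. R M x}) = (\<Sum>M\<in>S. card {x \<in> K. R M x})" by simp
  also have "\<dots> = (\<Sum>k\<in>K. card {M \<in> S. R M k})"
    using sum_multicount_gen[OF assms(1,2), of R "\<lambda>k. card {M \<in> S. R M k}"] by simp
  finally show ?thesis .
qed

lemma card_one_repeated:
  assumes "2 \<le> r"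
  shows "card (one_repeated_partitions r n)
       = (\<Sum>k=1..n. card (bounded_except r k (int n - int (r * k))))"
proof -
  let ?R = "\<lambda>M x. x \<in># M \<and> r \<le> count M x"
  have "card (one_repeated_partitions r n)
      = card {M \<in> mpartitions (int n). card {x. ?R M x} = 1}"
    using bij_betw_same_card[OF bij_betw_mset_partitions[of n "\<lambda>M. card {x. ?R M x} = 1"]]
    by (simp add: one_repeated_partitions_def count_mset)
  also have "\<dots> = (\<Sum>k=1..n. card {M \<in> mpartitions (int n). {x. ?R M x} = {k}})"
    by (rule card_singleton_eq_sum) (use mpartitions_bounds in \<open>auto simp: finite_mpartitions\<close>)
  also have "\<dots> = (\<Sum>k=1..n. card (bounded_except r k (int n - int (r * k))))"
  proof (rule sum.cong)
    fix k assume k: "k \<in> {1..n}"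
    have "({x. ?R M x} = {k}) \<longleftrightarrow> r \<le> count M k \<and> (\<forall>x. x \<noteq> k \<longrightarrow> count M x < r)" for M
    proof -
      have "?R M x \<longleftrightarrow> r \<le> count M x" for x
        using assms by (metis count_eq_zero_iff le_zero_eq not_numeral_le_zero)
      then show ?thesis by (simp add: set_eq_iff flip: not_le) blast
    qed
    then have "{M \<in> mpartitions (int n). {x. ?R M x} = {k}}
        = {M \<in> mpartitions (int n). r \<le> count M k \<and> (\<forall>x. x \<noteq> k \<longrightarrow> count M x < r)}"
      by simp
    then show "card {M \<in> mpartitions (int n). {x. ?R M x} = {k}}
        = card (bounded_except r k (int n - int (r * k)))"
      using card_mpartitions_remove[of k "int n" r "\<lambda>M. \<forall>x. x \<noteq> k \<longrightarrow> count M x < r"] k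
      by (simp add: bounded_except_def)
  qed simp
  finally show ?thesis .
qed

text \<open>The exceptional size has the form \<open>r * k\<close>; summing over \<open>k\<close> up to \<open>n\<close> rather than \<open>n div r\<close> adds only
  zero terms and matches the range in \<open>card_one_repeated\<close>.\<close>

lemma card_one_divisible:
  assumes "2 \<le> r"
  shows "card (one_divisible_partitions r n)
       = (\<Sum>k=1..n. card (bounded_except r k (int n - int (r * k))))"
proof -
  let ?R = "\<lambda>M x. x \<in># M \<and> r dvd x"
  have "card (one_divisible_partitions r n)
      = card {M \<in> mpartitions (int n). card {x. ?R M x} = 1}"
    using bij_betw_same_card[OF bij_betw_mset_partitions[of n "\<lambda>M. card {x. ?R M x} = 1"]]
    by (simp add: one_divisible_partitions_def)
  also have "\<dots> = (\<Sum>k\<in>(\<lambda>k. r * k) ` {1..n}. card {M \<in> mpartitions (int n). {x. ?R M x} = {k}})"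
  proof (rule card_singleton_eq_sum)
    fix M x assume M: "M \<in> mpartitions (int n)" and x: "x \<in># M \<and> r dvd x"
    from x obtain k where k: "x = r * k" by blast
    have "x \<in> {1..n}" using mpartitions_bounds M x by blast
    moreover from this have "0 < k" "k \<le> x" using k assms by auto
    ultimately have "k \<in> {1..n}" by simp
    then show "x \<in> (\<lambda>k. r * k) ` {1..n}" using k by blast
  qed (auto simp: finite_mpartitions)
  also have "\<dots> = (\<Sum>k=1..n. card {M \<in> mpartitions (int n). {x. ?R M x} = {r * k}})"
    by (rule sum.reindex_cong[of "\<lambda>k. r * k"]) (use assms in \<open>auto simp: inj_on_def\<close>)
  also have "\<dots> = (\<Sum>k=1..n. card (bounded_except r k (int n - int (r * k))))"
  proof (rule sum.cong)
    fix k assume k: "k \<in> {1..n}"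
    have "{M \<in> mpartitions (int n). {x. ?R M x} = {r * k}}
        = {M \<in> mpartitions (int n). 1 \<le> count M (r * k) \<and> (\<forall>x\<in>#M. r dvd x \<longrightarrow> x = r * k)}"
      by (auto simp: set_eq_iff Suc_le_eq)
    then show "card {M \<in> mpartitions (int n). {x. ?R M x} = {r * k}}
        = card (bounded_except r k (int n - int (r * k)))"
      using card_mpartitions_remove[of "r * k" "int n" 1 "\<lambda>M. \<forall>x\<in>#M. r dvd x \<longrightarrow> x = r * k"]
        card_one_multiple_eq_card_bounded_except[of r k "int n - int (r * k)"] k assms
      by simp
  qed simp
  finally show ?thesis .
qed

text \<open>For a fixed size \<open>k\<close>, consider all partitions with at least \<open>t\<close> copies of \<open>k\<close> and every other
  multiplicity below \<open>r\<close>. Either \<open>k\<close> too has multiplicity below \<open>r\<close>, and then \<open>k\<close> is counted on the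
  left, or it occurs at least \<open>r\<close> times. Stated additively to stay within the natural numbers.\<close>

lemma sum_num_sizes_repeated:
  assumes "1 \<le> t" "t \<le> r"
  shows "(\<Sum>xs\<in>bounded_mult_partitions r n. num_sizes_repeated t xs)
           + (\<Sum>k=1..n. card (bounded_except r k (int n - int (r * k))))
       = (\<Sum>k=1..n. card (bounded_except r k (int n - int (t * k))))"
proof -
  let ?D = "{M \<in> mpartitions (int n). \<forall>x. count M x < r}"
  have "(\<forall>x\<in>set xs. count_list xs x \<le> r - 1) \<longleftrightarrow> (\<forall>x. count (mset xs) x < r)"
    for xs :: "nat list"
  proof -
    have "x \<in> set xs \<and> r \<le> count_list xs x \<longleftrightarrow> r \<le> count_list xs x" for x
      using assms count_list_0_iff[of xs x] by (cases "x \<in> set xs") auto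
    moreover have "count_list xs x \<le> r - 1 \<longleftrightarrow> \<not> r \<le> count_list xs x" for x
      using assms by linarith
    ultimately show ?thesis by (simp add: count_mset flip: not_le) blast
  qed
  then have "bounded_mult_partitions r n = {xs \<in> partitions n. \<forall>x. count (mset xs) x < r}"
    by (simp add: bounded_mult_partitions_def)
  then have "(\<Sum>xs\<in>bounded_mult_partitions r n. num_sizes_repeated t xs)
      = (\<Sum>M\<in>?D. card {x. x \<in># M \<and> t \<le> count M x})"
    using sum.reindex_bij_betw[OF bij_betw_mset_partitions[of n "\<lambda>M. \<forall>x. count M x < r"],
        of "\<lambda>M. card {x. x \<in># M \<and> t \<le> count M x}"]
    by (simp add: num_sizes_repeated_def count_mset)
  also have "\<dots> = (\<Sum>k=1..n. card {M \<in> ?D. k \<in># M \<and> t \<le> count M k})"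
    by (rule sum_card_swap) (use mpartitions_bounds in auto)
  finally have "(\<Sum>xs\<in>bounded_mult_partitions r n. num_sizes_repeated t xs)
        + (\<Sum>k=1..n. card (bounded_except r k (int n - int (r * k))))
      = (\<Sum>k=1..n. card {M \<in> ?D. k \<in># M \<and> t \<le> count M k}
                     + card (bounded_except r k (int n - int (r * k))))"
    by (simp add: sum.distrib)
  also have "\<dots> = (\<Sum>k=1..n. card (bounded_except r k (int n - int (t * k))))"
  proof (rule sum.cong)
    fix k assume k: "k \<in> {1..n}"
    let ?Q = "\<lambda>M. \<forall>x. x \<noteq> k \<longrightarrow> count M x < r"
    let ?S = "\<lambda>Q. {M \<in> mpartitions (int n). Q M}"
    have rem: "card (?S (\<lambda>M. j \<le> count M k \<and> ?Q M)) = card (bounded_except r k (int n - int (j * k)))"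
      for j using card_mpartitions_remove[of k "int n" j ?Q] k by (simp add: bounded_except_def)
    have "k \<in># M" if "t \<le> count M k" for M
      using that assms(1) by (metis count_eq_zero_iff le_zero_eq not_one_le_zero)
    then have "t \<le> count M k \<and> ?Q M \<longleftrightarrow> (\<forall>x. count M x < r) \<and> k \<in># M \<and> t \<le> count M k
        \<or> r \<le> count M k \<and> ?Q M" for M
      using assms(2) by (metis le_trans not_le)
    then have "?S (\<lambda>M. t \<le> count M k \<and> ?Q M)
        = {M \<in> ?D. k \<in># M \<and> t \<le> count M k} \<union> ?S (\<lambda>M. r \<le> count M k \<and> ?Q M)" by blast
    moreover have "card \<dots> = card {M \<in> ?D. k \<in># M \<and> t \<le> count M k}
        + card (?S (\<lambda>M. r \<le> count M k \<and> ?Q M))"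
      by (rule card_Un_disjoint) (auto dest: leD)
    ultimately show "card {M \<in> ?D. k \<in># M \<and> t \<le> count M k}
        + card (bounded_except r k (int n - int (r * k))) = card (bounded_except r k (int n - int (t * k)))"
      by (simp only: flip: rem)
  qed simp
  finally show ?thesis .
qed

text \<open>Each occurrence of a part \<open>i\<close> congruent to \<open>t\<close> is recorded as a pair \<open>(i, j)\<close>, the \<open>j\<close>-th copy of
  \<open>i\<close>. The partitions containing it correspond to the \<open>r\<close>-regular partitions of \<open>n - i * j\<close>, since
  \<open>i\<close> itself is not divisible by \<open>r\<close>. Summing over \<open>i\<close> first and trading regular partitions for
  those with bounded multiplicities makes the inner sum an instance of \<open>card_bounded_except_eq_sum\<close>.\<close>

lemma sum_num_parts_cong:
  assumes "2 \<le> r" "1 \<le> t" "t \<le> r - 1"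
  shows "(\<Sum>xs\<in>regular_partitions r n. num_parts_cong r t xs)
       = (\<Sum>k=1..n. card (bounded_except r k (int n - int (t * k))))"
proof -
  let ?O = "\<lambda>n. {M \<in> mpartitions n. \<forall>x\<in>#M. \<not> r dvd x}"
  let ?I = "{i. i \<in> {t..n} \<and> [i = t] (mod r)}"
  \<comment> \<open>As \<open>t\<close> is the least positive member of its class, starting the range at \<open>t\<close> loses nothing.\<close>
  have I: "?I = {i \<in> {1..n}. [i = t] (mod r)}"
  proof -
    have "t \<le> i" if "1 \<le> i" "[i = t] (mod r)" for i
    proof -
      have "t = i mod r" using that assms by (simp add: cong_def)
      then show ?thesis by simp
    qed
    then show ?thesis using assms(2) by auto
  qed
  have "(\<Sum>xs\<in>regular_partitions r n. num_parts_cong r t xs)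
      = (\<Sum>M\<in>?O (int n). size (filter_mset (\<lambda>x. [x = t] (mod r)) M))"
    using sum.reindex_bij_betw[OF bij_betw_mset_partitions[of n "\<lambda>M. \<forall>x\<in>#M. \<not> r dvd x"],
        of "\<lambda>M. size (filter_mset (\<lambda>x. [x = t] (mod r)) M)"]
    by (simp add: num_parts_cong_def regular_partitions_def flip: mset_filter)
  also have "\<dots> = (\<Sum>M\<in>?O (int n).
      card {p. p \<in> ?I \<times> {1..n} \<and> snd p \<le> count M (fst p)})"
  proof (rule sum.cong)
    fix M assume M: "M \<in> ?O (int n)"
    let ?F = "filter_mset (\<lambda>x. [x = t] (mod r)) M"
    have "size ?F = (\<Sum>i\<in>?I. count ?F i)"
      unfolding size_multiset_overloaded_eq I
      by (rule sum.mono_neutral_left) (use M mpartitions_bounds in \<open>auto simp: not_in_iff\<close>)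
    also have "\<dots> = (\<Sum>i\<in>?I. card {j \<in> {1..n}. j \<le> count M i})"
    proof (rule sum.cong)
      fix i assume i: "i \<in> ?I"
      have "count M i \<le> n" using mpartitions_bounds(2)[of M n i] M by (cases "i \<in># M") (auto simp: not_in_iff)
      then have "{j \<in> {1..n}. j \<le> count M i} = {1..count M i}" by auto
      then show "count ?F i = card {j \<in> {1..n}. j \<le> count M i}" using i by simp
    qed simp
    also have "\<dots> = card (SIGMA i:?I. {j \<in> {1..n}. j \<le> count M i})"
      by (subst card_SigmaI) auto
    also have "(SIGMA i:?I. {j \<in> {1..n}. j \<le> count M i})
        = {p. p \<in> ?I \<times> {1..n} \<and> snd p \<le> count M (fst p)}" by auto
    finally show "size ?F = card {p. p \<in> ?I \<times> {1..n} \<and> snd p \<le> count M (fst p)}" .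
  qed simp
  also have "\<dots> = (\<Sum>p\<in>?I \<times> {1..n}.
      card {M \<in> ?O (int n). p \<in> ?I \<times> {1..n} \<and> snd p \<le> count M (fst p)})"
    by (rule sum_card_swap) simp_all
  also have "\<dots> = (\<Sum>p\<in>?I \<times> {1..n}. card (?O (int n - int (fst p * snd p))))"
  proof (rule sum.cong)
    fix p assume p: "p \<in> ?I \<times> {1..n}"
    obtain i j where ij: "p = (i, j)" by (cases p)
    have "\<not> r dvd i"
    proof
      assume "r dvd i"
      then have "t mod r = 0" using p ij by (simp add: cong_def)
      then show False using assms by simp
    qed
    then have "{M \<in> mpartitions m. \<forall>x\<in>#(M + replicate_mset j i). \<not> r dvd x} = ?O m" for m
      by auto
    moreover have "{M \<in> ?O (int n). p \<in> ?I \<times> {1..n} \<and> snd p \<le> count M (fst p)}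
        = {M \<in> mpartitions (int n). j \<le> count M i \<and> (\<forall>x\<in>#M. \<not> r dvd x)}"
      using p ij by auto
    moreover have "0 < i" using p ij assms(2) by simp
    ultimately show "card {M \<in> ?O (int n). p \<in> ?I \<times> {1..n} \<and> snd p \<le> count M (fst p)}
        = card (?O (int n - int (fst p * snd p)))"
      using card_mpartitions_remove[of i "int n" j "\<lambda>M. \<forall>x\<in>#M. \<not> r dvd x"]
      by (simp only: ij fst_conv snd_conv mult.commute[of i])
  qed simp
  also have "\<dots> = (\<Sum>k=1..n. \<Sum>i\<in>?I. card (?O (int n - int (i * k))))"
    by (subst sum.swap) (simp add: sum.cartesian_product split_def)
  also have "\<dots> = (\<Sum>k=1..n. card (bounded_except r k (int n - int (t * k))))"
  proof (rule sum.cong)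
    fix k assume "k \<in> {1..n}"
    then show "(\<Sum>i\<in>?I. card (?O (int n - int (i * k)))) = card (bounded_except r k (int n - int (t * k)))"
      using card_bounded_except_eq_sum[of r k n t] glaisher[of r] assms(1) by simp
  qed simp
  finally show ?thesis .
qed

theorem theorem1p2:
  fixes n r t :: nat
  assumes "2 \<le> r" and "1 \<le> t" and "t \<le> r - 1"
  shows "card (one_divisible_partitions r n) = card (one_repeated_partitions r n)
       \<and> int (card (one_repeated_partitions r n)) = E r t n"
proof
  show "card (one_divisible_partitions r n) = card (one_repeated_partitions r n)"
    using card_one_divisible card_one_repeated assms(1) by simp
  have "(\<Sum>xs\<in>bounded_mult_partitions r n. num_sizes_repeated t xs)
      + card (one_repeated_partitions r n)
      = (\<Sum>xs\<in>regular_partitions r n. num_parts_cong r t xs)"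
    using sum_num_sizes_repeated[of t r n] sum_num_parts_cong[OF assms, of n]
      card_one_repeated[OF assms(1), of n] assms by simp
  then show "int (card (one_repeated_partitions r n)) = E r t n"
    unfolding E_def by (simp flip: of_nat_sum)
qed

end
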